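(* Let $q\ge 2$ and $d\ge 2$ be integers and put $\kappa=(q^d-1)/(q-1)$. Suppose there is a symmetric $2$-$(m,\kappa,\lambda)$ design whose $(m\times m)$ incidence matrix $A$ is symmetric. Let $L=(e(i,j))$ be a symmetric $(m\times m)$ integer matrix obtained from $A$ by replacing, in each row, the $\kappa$ nonzero entries by the integers $1,2,\dots,\kappa$ bijectively (so $e(i,j)=0$ iff $A_{ij}=0$, and for each $i$ the map $j\mapsto e(i,j)$ is a bijection from $\{j: A_{ij}\neq 0\}$ onto $[\kappa]=\{1,\dots,\kappa\}$). Let $\mathcal{D}_1,\dots,\mathcal{D}_m$ be (not necessarily isomorphic) affine designs with parameters $(q,q^{d-2})$, $\mathcal{D}_i=(\mathcal{P}_i,\mathcal{B}_i)$, with pairwise disjoint point sets, each having $\kappa$ parallel classes, which are enumerated by $[\kappa]$; denote the $j$-th parallel class of $\mathcal{D}_i$ by $\mathcal{B}_i^j$, and for $x\in\mathcal{P}_i$ denote by $B_i^j(x)$ the block of $\mathcal{B}_i^j$ containing $x$. For each pair $(i,j)$ with $e(i,j)\neq 0$, choose a bijection $\sigma_{i,j}:\mathcal{B}_i^{e(i,j)}\to\mathcal{B}_j^{e(j,i)}$ such that $\sigma_{i,j}=\sigma_{j,i}^{-1}$ for $i\neq j$ and $\sigma_{i,i}$ is the identity map on $\mathcal{B}_i^{e(i,i)}$. Let $\Gamma$ be the graph with vertex set $\bigcup_{i=1}^m\mathcal{P}_i$, in which two different vertices $x\in\mathcal{P}_i$ and $y\in\mathcal{P}_j$ are adjacent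 if and only if $e(i,j)\neq 0$ and $y\notin\sigma_{i,j}\big(B_i^{e(i,j)}(x)\big)$. Then $\Gamma$ is a divisible design graph with parameters $$v=q^d m,\quad k=q^{d-1}(q^d-1),\quad \lambda_1=q^{d-1}(q^d-q^{d-1}-1),\quad \lambda_2=q^{d-2}(q-1)^2\lambda,\quad m,\quad n=q^d.$$
   Context: A $k$-regular graph on $v$ vertices is a divisible design graph with parameters $(v,k,\lambda_1,\lambda_2,m,n)$ if its vertex set can be partitioned into $m$ classes of size $n$ such that any two different vertices in the same class have exactly $\lambda_1$ common neighbours and any two vertices in different classes have exactly $\lambda_2$ common neighbours. A symmetric $2$-$(m,\kappa,\lambda)$ design has $m$ points and $m$ blocks, each block of size $\kappa$, any two distinct points lying in exactly $\lambda$ common blocks. An affine design with parameters $(q,r)$ is a $2$-design in which any two blocks are either disjoint or meet in exactly $r$ points, and each block together with all blocks disjoint from it forms a parallel class: a set of $q$ mutually disjoint blocks partitioning the point set. An affine design with parameters $(q,q^{d-2})$ has $q^d$ points, blocks of size $q^{d-1}$, $(q^d-1)/(q-1)$ parallel classes, and any two distinct points lie in exactly $(q^{d-1}-1)/(q-1)$ common blocks (e.g. the points and hyperplanes of the $d$-dimensional affine space over $\mathbb{F}_q$). *)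

theory Defs
  imports Main "HOL-Library.Multiset" "HOL-Library.Disjoint_Sets"
begin

text \<open>Blocks form a multiset, so repeated blocks are allowed. No condition such as \<open>2 \<le> k < v\<close>
  is imposed.\<close>

definition two_design :: "'a set \<Rightarrow> 'a set multiset \<Rightarrow> nat \<Rightarrow> nat \<Rightarrow> nat \<Rightarrow> bool" where
  "two_design P B v k l \<longleftrightarrow>
     finite P \<and> card P = v \<and>
     (\<forall>b \<in># B. b \<subseteq> P \<and> card b = k) \<and>
     (\<forall>x\<in>P. \<forall>y\<in>P. x \<noteq> y \<longrightarrow> size {#b \<in># B. x \<in> b \<and> y \<in> b#} = l)"

definition symmetric_two_design :: "'a set \<Rightarrow> 'a set multiset \<Rightarrow> nat \<Rightarrow> nat \<Rightarrow> nat \<Rightarrow> bool" where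
  "symmetric_two_design P B m k l \<longleftrightarrow> two_design P B m k l \<and> size B = m"

text \<open>Rows and columns are indexed by \<open>{1..m}\<close>; the values of \<open>A\<close> outside this range are irrelevant.\<close>

definition incidence_matrix ::
    "'a set \<Rightarrow> 'a set multiset \<Rightarrow> nat \<Rightarrow> (nat \<Rightarrow> nat \<Rightarrow> nat) \<Rightarrow> bool" where
  "incidence_matrix P B m A \<longleftrightarrow>
     (\<exists>p b. bij_betw p {1..m} P \<and> image_mset b (mset_set {1..m}) = B \<and>
        (\<forall>i\<in>{1..m}. \<forall>j\<in>{1..m}. A i j = of_bool (p i \<in> b j)))"

definition symmetric_matrix :: "nat \<Rightarrow> (nat \<Rightarrow> nat \<Rightarrow> nat) \<Rightarrow> bool" where
  "symmetric_matrix m A \<longleftrightarrow> (\<forall>i\<in>{1..m}. \<forall>j\<in>{1..m}. A i j = A j i)"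

definition parallel_class :: "'a set set \<Rightarrow> 'a set \<Rightarrow> 'a set set" where
  "parallel_class B b = insert b {c \<in> B. c \<inter> b = {}}"

definition parallel_classes :: "'a set set \<Rightarrow> 'a set set set" where
  "parallel_classes B = parallel_class B ` B"

definition affine_design :: "'a set \<Rightarrow> 'a set set \<Rightarrow> nat \<Rightarrow> nat \<Rightarrow> bool" where
  "affine_design P B q r \<longleftrightarrow>
     finite B \<and> (\<exists>v k l. two_design P (mset_set B) v k l) \<and>
     (\<forall>b\<in>B. \<forall>c\<in>B. b \<noteq> c \<longrightarrow> b \<inter> c = {} \<or> card (b \<inter> c) = r) \<and>
     (\<forall>b\<in>B. partition_on P (parallel_class B b) \<and> card (parallel_class B b) = q)"

definition block_through :: "'a set set \<Rightarrow> 'a \<Rightarrow> 'a set" where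
  "block_through C x = (THE b. b \<in> C \<and> x \<in> b)"

definition gamma_adj ::
    "nat \<Rightarrow> (nat \<Rightarrow> nat \<Rightarrow> nat) \<Rightarrow> (nat \<Rightarrow> 'a set) \<Rightarrow> (nat \<Rightarrow> nat \<Rightarrow> 'a set set) \<Rightarrow>
     (nat \<Rightarrow> nat \<Rightarrow> 'a set \<Rightarrow> 'a set) \<Rightarrow> 'a \<Rightarrow> 'a \<Rightarrow> bool" where
  "gamma_adj m e P C \<sigma> x y \<longleftrightarrow>
     (\<exists>i\<in>{1..m}. \<exists>j\<in>{1..m}. x \<in> P i \<and> y \<in> P j \<and> x \<noteq> y \<and>
        e i j \<noteq> 0 \<and> y \<notin> \<sigma> i j (block_through (C i (e i j)) x))"

definition simple_graph :: "'a set \<Rightarrow> ('a \<Rightarrow> 'a \<Rightarrow> bool) \<Rightarrow> bool" where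
  "simple_graph V adj \<longleftrightarrow>
     finite V \<and> (\<forall>x y. adj x y \<longrightarrow> x \<in> V \<and> y \<in> V \<and> x \<noteq> y \<and> adj y x)"

definition common_neighbours :: "'a set \<Rightarrow> ('a \<Rightarrow> 'a \<Rightarrow> bool) \<Rightarrow> 'a \<Rightarrow> 'a \<Rightarrow> 'a set" where
  "common_neighbours V adj x y = {z \<in> V. adj x z \<and> adj y z}"

definition divisible_design_graph ::
    "'a set \<Rightarrow> ('a \<Rightarrow> 'a \<Rightarrow> bool) \<Rightarrow> nat \<Rightarrow> nat \<Rightarrow> nat \<Rightarrow> nat \<Rightarrow> nat \<Rightarrow> nat \<Rightarrow> bool" where
  "divisible_design_graph V adj v k l1 l2 m n \<longleftrightarrow>
     simple_graph V adj \<and> card V = v \<and> (\<forall>x\<in>V. card {y \<in> V. adj x y} = k) \<and>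
     (\<exists>K. partition_on V K \<and> card K = m \<and> (\<forall>c\<in>K. card c = n) \<and>
        (\<forall>c\<in>K. \<forall>x\<in>c. \<forall>y\<in>c. x \<noteq> y \<longrightarrow> card (common_neighbours V adj x y) = l1) \<and>
        (\<forall>c\<in>K. \<forall>c'\<in>K. c \<noteq> c' \<longrightarrow>
           (\<forall>x\<in>c. \<forall>y\<in>c'. card (common_neighbours V adj x y) = l2)))"

end

theory Submission
  imports Defs
begin

text \<open>
  Blocks of an affine design from different parallel classes meet in \<open>r\<close> points, so every block has
  \<open>q * r\<close> points and the design has \<open>q * q * r\<close> points. The condition \<open>x \<noteq> y\<close> in the adjacency
  relation is automatic, because \<open>\<sigma> i i\<close> is the identity. Hence the neighbourhood of \<open>x \<in> P i\<close>
  is the disjoint union, over the \<open>\<kappa>\<close> indices \<open>j\<close> with \<open>e i j \<noteq> 0\<close>, of \<open>P j\<close> minus one block.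

  For distinct \<open>x, y\<close> in the same \<open>P i\<close>, the removed blocks in \<open>P j\<close> coincide or are disjoint,
  and they coincide exactly when \<open>x\<close> and \<open>y\<close> lie in a common block of the class \<open>C i (e i j)\<close>; the
  number of such \<open>j\<close> is the constant of the affine 2-design. For \<open>x \<in> P i\<close>, \<open>y \<in> P i'\<close> with
  \<open>i \<noteq> i'\<close>, there are \<open>l\<close> common indices \<open>j\<close>, and the removed blocks in \<open>P j\<close> come from different
  parallel classes because row \<open>j\<close> of \<open>e\<close> is injective on its support.
\<close>

section \<open>Blocks of a partition through a point, and an inclusion-exclusion count\<close>

lemma block_through_partition:
  assumes "partition_on P K" "x \<in> P"
  shows "block_through K x \<in> K" "x \<in> block_through K x"
proof -
  have "\<exists>!b. b \<in> K \<and> x \<in> b"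
    using assms partition_onD1[OF assms(1)] partition_onD2[OF assms(1)]
    unfolding disjoint_def by blast
  from theI'[OF this] show "block_through K x \<in> K" "x \<in> block_through K x"
    unfolding block_through_def by auto
qed

lemma block_through_unique:
  assumes "partition_on P K" "b \<in> K" "x \<in> b"
  shows "block_through K x = b"
proof -
  have x: "x \<in> P"
    using assms partition_onD1 by fastforce
  show ?thesis
    using block_through_partition[OF assms(1) x] assms partition_onD2[OF assms(1)]
    unfolding disjoint_def by blast
qed

text \<open>Inclusion-exclusion arranged additively, so that no truncated subtraction of naturals
  occurs.\<close>

lemma card_Diff_Un:
  assumes "finite P" "S \<subseteq> P" "T \<subseteq> P"
  shows "card (P - (S \<union> T)) + card S + card T = card P + card (S \<inter> T)"
proof -
  have "card (P - (S \<union> T)) + card (S \<union> T) = card P"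
    using assms by (metis Un_least card_Diff_subset card_mono finite_subset le_add_diff_inverse2)
  moreover have "card S + card T = card (S \<union> T) + card (S \<inter> T)"
    using assms by (meson card_Un_Int finite_subset)
  ultimately show ?thesis by linarith
qed

section \<open>Counting in a single affine design\<close>

locale affine =
  fixes P :: "'a set" and B :: "'a set set" and q r :: nat
  assumes affine: "affine_design P B q r"
begin

lemma finite_points: "finite P"
  and finite_blocks: "finite B"
  and blocks_meet: "\<lbrakk>b \<in> B; c \<in> B; b \<noteq> c; b \<inter> c \<noteq> {}\<rbrakk> \<Longrightarrow> card (b \<inter> c) = r"
  and partition_parallel_class: "b \<in> B \<Longrightarrow> partition_on P (parallel_class B b)"
  and card_parallel_class: "b \<in> B \<Longrightarrow> card (parallel_class B b) = q"
  using affine unfolding affine_design_def two_design_def by blast+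

text \<open>The class of \<open>b\<close> is a partition, so its members are disjoint from or equal
  to \<open>c\<close>, which puts them in the class of \<open>c\<close>. Since \<open>b\<close> in
  turn lies in the class of \<open>c\<close>, the same argument gives the other inclusion.\<close>

lemma parallel_class_eq:
  assumes b: "b \<in> B" and c: "c \<in> parallel_class B b"
  shows "parallel_class B c = parallel_class B b"
proof -
  have sub: "parallel_class B b \<subseteq> parallel_class B c"
    if "b \<in> B" "c \<in> parallel_class B b" for b c
    using that partition_onD2[OF partition_parallel_class[OF that(1)]]
    unfolding disjoint_def parallel_class_def by blast
  have "c \<in> B" "b \<in> parallel_class B c"
    using b c unfolding parallel_class_def by auto
  with sub b c show ?thesis by blast
qed

lemma
  assumes "K \<in> parallel_classes B"
  shows partition_class: "partition_on P K" and card_class: "card K = q"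
    and class_subset: "K \<subseteq> B"
  using assms partition_parallel_class card_parallel_class
  unfolding parallel_classes_def by (auto simp: parallel_class_def)

lemma class_eq:
  assumes "K \<in> parallel_classes B" "b \<in> K"
  shows "K = parallel_class B b"
  using assms parallel_class_eq unfolding parallel_classes_def by auto

text \<open>If \<open>b\<close> and \<open>c\<close> were equal or disjoint, \<open>c\<close> would
  lie in the parallel class of \<open>b\<close> and the two classes would coincide. Hence the blocks
  meet, and then they meet in \<open>r\<close> points.\<close>

lemma card_Int_different_classes:
  assumes "K \<in> parallel_classes B" "K' \<in> parallel_classes B" "K \<noteq> K'" "b \<in> K" "c \<in> K'"
  shows "card (b \<inter> c) = r"
proof (rule blocks_meet)
  show B: "b \<in> B" "c \<in> B" using assms class_subset by auto
  have "c \<notin> parallel_class B b"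
    using assms class_eq parallel_class_eq B by metis
  then show "b \<noteq> c" "b \<inter> c \<noteq> {}"
    using B unfolding parallel_class_def by auto
qed

lemma finite_block: "b \<in> B \<Longrightarrow> finite b"
  and block_subset: "b \<in> B \<Longrightarrow> b \<subseteq> P"
proof -
  show "b \<in> B \<Longrightarrow> b \<subseteq> P"
    using partition_onD1[OF partition_parallel_class, of b] unfolding parallel_class_def by blast
  then show "b \<in> B \<Longrightarrow> finite b" using finite_points finite_subset by blast
qed

lemma sum_card_class:
  assumes "K \<in> parallel_classes B" "S \<subseteq> P"
  shows "card S = (\<Sum>c\<in>K. card (S \<inter> c))"
proof -
  have "S = (\<Union>c\<in>K. S \<inter> c)"
    using assms partition_onD1[OF partition_class[OF assms(1)]] by auto
  also have "card \<dots> = (\<Sum>c\<in>K. card (S \<inter> c))"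
  proof (rule card_UN_disjoint)
    show "finite K" using assms(1) class_subset finite_blocks finite_subset by blast
    show "\<forall>c\<in>K. finite (S \<inter> c)" using assms(2) finite_points finite_subset by blast
    show "\<forall>c\<in>K. \<forall>c'\<in>K. c \<noteq> c' \<longrightarrow> (S \<inter> c) \<inter> (S \<inter> c') = {}"
      using partition_onD2[OF partition_class[OF assms(1)]] unfolding disjoint_def by blast
  qed
  finally show ?thesis .
qed

text \<open>A second parallel class cuts \<open>b\<close> into \<open>q\<close> pieces of
  \<open>r\<close> points each; the bound on the number of classes provides that second
  class.\<close>

lemma card_block:
  assumes "2 \<le> card (parallel_classes B)" "b \<in> B"
  shows "card b = q * r"
proof -
  let ?K = "parallel_class B b"
  have K: "?K \<in> parallel_classes B" "b \<in> ?K"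
    using assms(2) unfolding parallel_classes_def parallel_class_def by auto
  have "\<not> parallel_classes B \<subseteq> {?K}"
    using assms(1) card_mono[of "{?K}" "parallel_classes B"] by auto
  then obtain K' where K': "K' \<in> parallel_classes B" "?K \<noteq> K'" by blast
  have "card b = (\<Sum>c\<in>K'. card (b \<inter> c))"
    by (rule sum_card_class[OF K'(1) block_subset[OF assms(2)]])
  also have "\<dots> = (\<Sum>c\<in>K'. r)"
    using card_Int_different_classes[OF K(1) K'(1) K'(2) K(2)] by simp
  finally show ?thesis using card_class[OF K'(1)] by simp
qed

lemma card_points:
  assumes "2 \<le> card (parallel_classes B)"
  shows "card P = q * q * r"
proof -
  obtain K where K: "K \<in> parallel_classes B" using assms by fastforce
  have "card P = (\<Sum>c\<in>K. card (P \<inter> c))" by (rule sum_card_class[OF K order_refl])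
  also have "\<dots> = (\<Sum>c\<in>K. q * r)"
  proof (rule sum.cong[OF refl])
    fix c assume "c \<in> K"
    then have "c \<in> B" using class_subset[OF K] by blast
    then show "card (P \<inter> c) = q * r"
      using card_block[OF assms] block_subset by (simp add: Int_absorb1)
  qed
  finally show ?thesis using card_class[OF K] by simp
qed

text \<open>Every class contains exactly one block through \<open>x\<close>, and a block determines
  its class. This translates counts of classes into counts of blocks through a point.\<close>

lemma bij_block_through:
  assumes "x \<in> P"
  shows "bij_betw (\<lambda>K. block_through K x) (parallel_classes B) {b \<in> B. x \<in> b}"
proof (rule bij_betw_byWitness[where f' = "parallel_class B"])
  show "\<forall>K\<in>parallel_classes B. parallel_class B (block_through K x) = K"
    using assms block_through_partition(1)[OF partition_class] class_eq by metis
  show "\<forall>b\<in>{b \<in> B. x \<in> b}. block_through (parallel_class B b) x = b"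
    using block_through_unique[OF partition_parallel_class] by (auto simp: parallel_class_def)
  show "(\<lambda>K. block_through K x) ` parallel_classes B \<subseteq> {b \<in> B. x \<in> b}"
    using assms block_through_partition[OF partition_class] class_subset by blast
  show "parallel_class B ` {b \<in> B. x \<in> b} \<subseteq> parallel_classes B"
    unfolding parallel_classes_def by auto
qed

text \<open>Double counting of pairs \<open>(z, b)\<close> where the block \<open>b\<close> contains
  \<open>x\<close> and the point \<open>z \<noteq> x\<close>. The 2-design constant \<open>l\<close>
  of the design is the number of classes in which \<open>x\<close> and \<open>y\<close> share a
  block; the product form eliminates \<open>l\<close> without a division.\<close>

lemma card_common_classes:
  assumes "2 \<le> card (parallel_classes B)" "x \<in> P" "y \<in> P" "x \<noteq> y"
  shows "card {K \<in> parallel_classes B. block_through K x = block_through K y} * (q * q * r - 1)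
    = card (parallel_classes B) * (q * r - 1)"
proof -
  obtain l where l: "\<And>x y. x \<in> P \<Longrightarrow> y \<in> P \<Longrightarrow> x \<noteq> y \<Longrightarrow> card {b \<in> B. x \<in> b \<and> y \<in> b} = l"
    using affine unfolding affine_design_def two_design_def by (auto simp: finite_blocks)
  let ?Bx = "{b \<in> B. x \<in> b}"
  have "(\<Sum>b\<in>?Bx. card {z \<in> P - {x}. z \<in> b}) = l * card (P - {x})"
  proof (rule sum_multicount)
    show "\<forall>z\<in>P - {x}. card {b \<in> ?Bx. z \<in> b} = l"
      using l[OF assms(2)] by (auto simp: conj_assoc)
  qed (use finite_points finite_blocks in auto)
  moreover have "card {z \<in> P - {x}. z \<in> b} = q * r - 1" if "b \<in> ?Bx" for b
  proof -
    have "{z \<in> P - {x}. z \<in> b} = b - {x}" using that block_subset by auto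
    then show ?thesis using that card_block[OF assms(1)] finite_block by simp
  qed
  moreover have "card ?Bx = card (parallel_classes B)"
    using bij_betw_same_card[OF bij_block_through[OF assms(2)]] by simp
  moreover have "card (P - {x}) = q * q * r - 1"
    using card_points[OF assms(1)] assms(2) finite_points by simp
  ultimately have count: "card (parallel_classes B) * (q * r - 1) = l * (q * q * r - 1)"
    by simp
  have same: "block_through K x = block_through K y \<longleftrightarrow> y \<in> block_through K x"
    if "K \<in> parallel_classes B" for K
    using block_through_partition[OF partition_class[OF that]] assms
      block_through_unique[OF partition_class[OF that]] by metis
  have "bij_betw (\<lambda>K. block_through K x)
      {K \<in> parallel_classes B. block_through K x = block_through K y} {b \<in> B. x \<in> b \<and> y \<in> b}"
    using bij_betw_Collect[OF bij_block_through[OF assms(2)], of "\<lambda>b. y \<in> b"] same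
    by (simp cong: conj_cong)
  then have "card {K \<in> parallel_classes B. block_through K x = block_through K y} = l"
    using bij_betw_same_card l[OF assms(2-4)] by fastforce
  with count show ?thesis by simp
qed

end

section \<open>Common columns of the incidence matrix, and the data of the gluing\<close>

lemma card_common_columns:
  assumes "symmetric_two_design X Y m k l" "incidence_matrix X Y m A"
    and "i \<in> {1..m}" "i' \<in> {1..m}" "i \<noteq> i'"
  shows "card {j \<in> {1..m}. A i j \<noteq> 0 \<and> A i' j \<noteq> 0} = l"
proof -
  obtain p b where p: "bij_betw p {1..m} X" and Y: "image_mset b (mset_set {1..m}) = Y"
    and A: "\<forall>i\<in>{1..m}. \<forall>j\<in>{1..m}. A i j = of_bool (p i \<in> b j)"
    using assms(2) unfolding incidence_matrix_def by blast
  have "p i \<in> X" "p i' \<in> X" "p i \<noteq> p i'"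
    using bij_betwE[OF p] inj_onD[OF bij_betw_imp_inj_on[OF p]] assms(3-5) by blast+
  then have "size {#c \<in># Y. p i \<in> c \<and> p i' \<in> c#} = l"
    using assms(1) unfolding symmetric_two_design_def two_design_def by blast
  \<comment> \<open>Columns list the blocks with multiplicity, so sizes in the multiset
    \<open>Y\<close> become numbers of column indices even when blocks repeat.\<close>
  then have "card {j \<in> {1..m}. p i \<in> b j \<and> p i' \<in> b j} = l"
    unfolding Y[symmetric] by (simp add: filter_mset_image_mset)
  also have "{j \<in> {1..m}. p i \<in> b j \<and> p i' \<in> b j} = {j \<in> {1..m}. A i j \<noteq> 0 \<and> A i' j \<noteq> 0}"
    using A assms(3,4) by auto
  finally show ?thesis .
qed

text \<open>The exponent \<open>d\<close> is hidden: \<open>r\<close> stands for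
  \<open>q ^ (d - 2)\<close>, and the value of \<open>\<kappa>\<close> enters only through
  \<open>\<kappa> * (q - 1) = q * q * r - 1\<close>. The symmetric design survives only as the
  number \<open>l\<close> of common support columns of two rows of \<open>e\<close>.\<close>

locale affine_gluing =
  fixes q r m \<kappa> l :: nat
    and e :: "nat \<Rightarrow> nat \<Rightarrow> nat"
    and P :: "nat \<Rightarrow> 'a set" and B :: "nat \<Rightarrow> 'a set set"
    and C :: "nat \<Rightarrow> nat \<Rightarrow> 'a set set"
    and \<sigma> :: "nat \<Rightarrow> nat \<Rightarrow> 'a set \<Rightarrow> 'a set"
  assumes q: "2 \<le> q" and r: "1 \<le> r" and kappa: "\<kappa> * (q - 1) = q * q * r - 1"
    and sym: "\<lbrakk>i \<in> {1..m}; j \<in> {1..m}\<rbrakk> \<Longrightarrow> e i j = e j i"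
    and row: "i \<in> {1..m} \<Longrightarrow> bij_betw (e i) {j \<in> {1..m}. e i j \<noteq> 0} {1..\<kappa>}"
    and common_columns: "\<lbrakk>i \<in> {1..m}; i' \<in> {1..m}; i \<noteq> i'\<rbrakk> \<Longrightarrow>
      card {j \<in> {1..m}. e i j \<noteq> 0 \<and> e i' j \<noteq> 0} = l"
    and designs: "i \<in> {1..m} \<Longrightarrow> affine (P i) (B i) q r"
    and disj: "disjoint_family_on P {1..m}"
    and classes: "i \<in> {1..m} \<Longrightarrow> bij_betw (C i) {1..\<kappa>} (parallel_classes (B i))"
    and sigma: "\<lbrakk>i \<in> {1..m}; j \<in> {1..m}; e i j \<noteq> 0\<rbrakk> \<Longrightarrow>
      bij_betw (\<sigma> i j) (C i (e i j)) (C j (e j i))"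
    and sigma_inv: "\<lbrakk>i \<in> {1..m}; j \<in> {1..m}; i \<noteq> j; e i j \<noteq> 0; b \<in> C i (e i j)\<rbrakk> \<Longrightarrow>
      \<sigma> i j b = inv_into (C j (e j i)) (\<sigma> j i) b"
    and sigma_id: "\<lbrakk>i \<in> {1..m}; e i i \<noteq> 0; b \<in> C i (e i i)\<rbrakk> \<Longrightarrow> \<sigma> i i b = b"
begin

section \<open>The glued graph and the blocks removed from neighbourhoods\<close>

abbreviation "adj \<equiv> gamma_adj m e P C \<sigma>"
abbreviation "V \<equiv> \<Union>i\<in>{1..m}. P i"

definition supp :: "nat \<Rightarrow> nat set" where
  "supp i = {j \<in> {1..m}. e i j \<noteq> 0}"

text \<open>For \<open>x \<in> P i\<close> and \<open>j \<in> supp i\<close>, this is the set of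
  points of \<open>P j\<close> not adjacent to \<open>x\<close>, with \<open>x\<close> itself among
  them when \<open>j = i\<close>.\<close>

definition blk :: "nat \<Rightarrow> nat \<Rightarrow> 'a \<Rightarrow> 'a set" where
  "blk i j x = \<sigma> i j (block_through (C i (e i j)) x)"

text \<open>Supplies the two parallel classes on which the block and point counts depend. With
  \<open>\<kappa> \<le> 1\<close> the equation for \<open>\<kappa>\<close> would force
  \<open>q * q * r \<le> q\<close>.\<close>

lemma two_le_kappa: "2 \<le> \<kappa>"
proof (rule ccontr)
  assume "\<not> 2 \<le> \<kappa>"
  then have "\<kappa> * (q - 1) \<le> 1 * (q - 1)" by (intro mult_right_mono) auto
  moreover have "q * 2 * 1 \<le> q * q * r" using q r by (intro mult_mono) auto
  ultimately show False using kappa q by linarith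
qed

lemma card_parallel_classes: "i \<in> {1..m} \<Longrightarrow> card (parallel_classes (B i)) = \<kappa>"
  using bij_betw_same_card[OF classes] by simp

lemma card_part: "i \<in> {1..m} \<Longrightarrow> card (P i) = q * q * r"
  using affine.card_points[OF designs] card_parallel_classes two_le_kappa by simp

lemma finite_part: "i \<in> {1..m} \<Longrightarrow> finite (P i)"
  using affine.finite_points[OF designs] .

lemma part_unique: "\<lbrakk>i \<in> {1..m}; j \<in> {1..m}; x \<in> P i; x \<in> P j\<rbrakk> \<Longrightarrow> i = j"
  using disj unfolding disjoint_family_on_def by blast

lemma suppD: "\<lbrakk>i \<in> {1..m}; j \<in> supp i\<rbrakk> \<Longrightarrow> j \<in> {1..m} \<and> i \<in> supp j \<and> e i j = e j i \<and> e i j \<in> {1..\<kappa>}"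
  using sym[of i j] bij_betwE[OF row, of i] unfolding supp_def by auto

lemma finite_supp: "finite (supp i)"
  unfolding supp_def by simp

lemma class_in: "\<lbrakk>i \<in> {1..m}; j \<in> supp i\<rbrakk> \<Longrightarrow> C i (e i j) \<in> parallel_classes (B i)"
  using bij_betwE[OF classes] suppD by blast

lemma partition_C: "\<lbrakk>i \<in> {1..m}; j \<in> supp i\<rbrakk> \<Longrightarrow> partition_on (P i) (C i (e i j))"
  using affine.partition_class[OF designs class_in] .

lemma blk_in:
  assumes "i \<in> {1..m}" "j \<in> supp i" "x \<in> P i"
  shows "blk i j x \<in> C j (e j i)"
  using bij_betwE[OF sigma[of i j]] block_through_partition(1)[OF partition_C] assms
  unfolding blk_def supp_def by auto

lemma blk_in_blocks:
  assumes "i \<in> {1..m}" "j \<in> supp i" "x \<in> P i"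
  shows "blk i j x \<in> B j"
  using blk_in[OF assms] class_in[of j i] suppD[OF assms(1,2)]
    affine.class_subset[OF designs, of j] by blast

lemma blk_subset: "\<lbrakk>i \<in> {1..m}; j \<in> supp i; x \<in> P i\<rbrakk> \<Longrightarrow> blk i j x \<subseteq> P j"
  using blk_in_blocks affine.block_subset[OF designs] suppD by blast

lemma card_blk: "\<lbrakk>i \<in> {1..m}; j \<in> supp i; x \<in> P i\<rbrakk> \<Longrightarrow> card (blk i j x) = q * r"
  using blk_in_blocks affine.card_block[OF designs] suppD card_parallel_classes two_le_kappa
  by metis

lemma mem_blk_self:
  assumes "i \<in> {1..m}" "i \<in> supp i" "x \<in> P i"
  shows "x \<in> blk i i x"
  using block_through_partition[OF partition_C] sigma_id assms
  unfolding blk_def supp_def by auto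

text \<open>Disjointness of the parts makes the indices quantified in \<open>gamma_adj\<close>
  unique. Within one part, \<open>x\<close> belongs to its own removed block, so a point outside
  that block differs from \<open>x\<close>.\<close>

lemma adj_iff:
  assumes "i \<in> {1..m}" "x \<in> P i" "j \<in> {1..m}" "y \<in> P j"
  shows "adj x y \<longleftrightarrow> j \<in> supp i \<and> y \<notin> blk i j x"
proof
  assume "adj x y"
  then show "j \<in> supp i \<and> y \<notin> blk i j x"
    unfolding gamma_adj_def blk_def supp_def using part_unique assms by blast
next
  assume R: "j \<in> supp i \<and> y \<notin> blk i j x"
  then have "x \<noteq> y" using mem_blk_self part_unique assms by blast
  with R show "adj x y" unfolding gamma_adj_def blk_def supp_def using assms by blast
qed

text \<open>The block of \<open>y\<close> in the class joined to \<open>i\<close> is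
  \<open>blk i j x\<close> itself, and \<open>\<sigma> j i\<close> sends it back to the block of
  \<open>x\<close>. This is the symmetry of adjacency.\<close>

lemma mem_blk_sym:
  assumes "i \<in> {1..m}" "j \<in> supp i" "x \<in> P i" "y \<in> P j" "y \<in> blk i j x"
  shows "x \<in> blk j i y"
proof -
  note j = suppD[OF assms(1,2)]
  let ?b = "block_through (C i (e i j)) x"
  have b: "?b \<in> C i (e i j)" "x \<in> ?b"
    using block_through_partition[OF partition_C] assms by auto
  have "block_through (C j (e j i)) y = blk i j x"
    using j assms by (intro block_through_unique[OF partition_C] blk_in) auto
  then have eq: "blk j i y = \<sigma> j i (\<sigma> i j ?b)" unfolding blk_def by simp
  have "\<sigma> j i (\<sigma> i j ?b) = ?b"
  proof (cases "i = j")
    case True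
    then show ?thesis using sigma_id b assms(1,2) unfolding supp_def by auto
  next
    case False
    have "bij_betw (\<sigma> j i) (C j (e j i)) (C i (e i j))"
      using sigma j assms(1) unfolding supp_def by blast
    then show ?thesis
      using sigma_inv[of i j ?b] False b(1) assms(1,2) unfolding supp_def
      by (simp add: bij_betw_inv_into_right)
  qed
  with eq b show ?thesis by simp
qed

lemma simple_graph: "simple_graph V adj"
  unfolding simple_graph_def
proof (intro conjI allI impI)
  show "finite V" using finite_part by blast
  fix x y assume xy: "adj x y"
  then show "x \<in> V" "y \<in> V" "x \<noteq> y" unfolding gamma_adj_def by auto
  then obtain i j where ij: "i \<in> {1..m}" "x \<in> P i" "j \<in> {1..m}" "y \<in> P j" by blast
  with xy have "j \<in> supp i" "y \<notin> blk i j x" using adj_iff by auto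
  then show "adj y x" using ij suppD mem_blk_sym adj_iff[OF ij(3,4,1,2)] by blast
qed

section \<open>Degrees and common neighbours, part by part\<close>

lemma common_neighbours_eq:
  assumes "i \<in> {1..m}" "x \<in> P i" "i' \<in> {1..m}" "y \<in> P i'"
  shows "common_neighbours V adj x y
    = (\<Union>j\<in>supp i \<inter> supp i'. P j - (blk i j x \<union> blk i' j y))"
  using adj_iff[OF assms(1,2)] adj_iff[OF assms(3,4)]
  unfolding common_neighbours_def supp_def by auto

lemma card_common_neighbours:
  assumes "i \<in> {1..m}" "x \<in> P i" "i' \<in> {1..m}" "y \<in> P i'"
  shows "card (common_neighbours V adj x y)
    = (\<Sum>j\<in>supp i \<inter> supp i'. card (P j - (blk i j x \<union> blk i' j y)))"
  unfolding common_neighbours_eq[OF assms]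
proof (rule card_UN_disjoint)
  show "finite (supp i \<inter> supp i')" by (simp add: finite_supp)
  show "\<forall>j\<in>supp i \<inter> supp i'. finite (P j - (blk i j x \<union> blk i' j y))"
    using finite_part unfolding supp_def by blast
  show "\<forall>j\<in>supp i \<inter> supp i'. \<forall>j'\<in>supp i \<inter> supp i'. j \<noteq> j' \<longrightarrow>
      (P j - (blk i j x \<union> blk i' j y)) \<inter> (P j' - (blk i j' x \<union> blk i' j' y)) = {}"
    using part_unique unfolding supp_def by blast
qed

lemma card_supp: "i \<in> {1..m} \<Longrightarrow> card (supp i) = \<kappa>"
  using bij_betw_same_card[OF row] unfolding supp_def by simp

lemma card_Diff_blk:
  assumes "i \<in> {1..m}" "x \<in> P i" "i' \<in> {1..m}" "y \<in> P i'" "j \<in> supp i \<inter> supp i'"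
  shows "card (P j - (blk i j x \<union> blk i' j y)) + 2 * (q * r)
    = q * q * r + card (blk i j x \<inter> blk i' j y)"
proof -
  have j: "j \<in> supp i" "j \<in> supp i'" "j \<in> {1..m}"
    using assms(5) unfolding supp_def by auto
  show ?thesis
    using card_Diff_Un[OF finite_part[OF j(3)] blk_subset[OF assms(1) j(1) assms(2)]
        blk_subset[OF assms(3) j(2) assms(4)]]
    unfolding card_blk[OF assms(1) j(1) assms(2)] card_blk[OF assms(3) j(2) assms(4)]
      card_part[OF j(3)] by linarith
qed

lemma degree:
  assumes "x \<in> V"
  shows "card {y \<in> V. adj x y} = q * r * (q * q * r - 1)"
proof -
  obtain i where i: "i \<in> {1..m}" "x \<in> P i" using assms by blast
  \<comment> \<open>The degree is the diagonal case of the common neighbour count, where the two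
    removed blocks coincide.\<close>
  have "{y \<in> V. adj x y} = common_neighbours V adj x x"
    unfolding common_neighbours_def by simp
  also have "card \<dots> = (\<Sum>j\<in>supp i. card (P j - blk i j x))"
    using card_common_neighbours[OF i i] by simp
  also have "\<dots> = (\<Sum>j\<in>supp i. q * r * (q - 1))"
  proof (rule sum.cong[OF refl])
    fix j assume j: "j \<in> supp i"
    then show "card (P j - blk i j x) = q * r * (q - 1)"
      using card_Diff_blk[OF i i, of j] card_blk[OF i(1) j i(2)]
      by (simp add: diff_mult_distrib2 ac_simps)
  qed
  also have "\<dots> = q * r * (\<kappa> * (q - 1))" using card_supp[OF i(1)] by simp
  finally show ?thesis unfolding kappa .
qed

text \<open>An index in \<open>T\<close> contributes \<open>q * q * r - q * r\<close> common
  neighbours, any other index of \<open>supp i\<close> contributes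
  \<open>q * q * r - 2 * (q * r)\<close>. It remains to relate the size of \<open>T\<close> to
  \<open>\<kappa>\<close>.\<close>

lemma card_common_same_part:
  assumes i: "i \<in> {1..m}" and x: "x \<in> P i" and y: "y \<in> P i" and "x \<noteq> y"
  shows "card (common_neighbours V adj x y) = q * r * (q * q * r - q * r - 1)"
proof -
  define T where "T = {j \<in> supp i. blk i j x = blk i j y}"
  have T_eq: "T = {j \<in> supp i. block_through (C i (e i j)) x = block_through (C i (e i j)) y}"
  proof -
    have "blk i j x = blk i j y \<longleftrightarrow>
        block_through (C i (e i j)) x = block_through (C i (e i j)) y" if "j \<in> supp i" for j
    proof -
      have "inj_on (\<sigma> i j) (C i (e i j))"
        using sigma that i unfolding supp_def bij_betw_def by blast
      then show ?thesis
        unfolding blk_def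
        by (rule inj_on_eq_iff) (use block_through_partition(1)[OF partition_C[OF i that]] x y in auto)
    qed
    then show ?thesis unfolding T_def by blast
  qed
  have "bij_betw (C i \<circ> e i) (supp i) (parallel_classes (B i))"
    using bij_betw_trans[OF row[OF i] classes[OF i]] unfolding supp_def .
  then have "bij_betw (C i \<circ> e i) T
      {K \<in> parallel_classes (B i). block_through K x = block_through K y}"
    unfolding T_eq by (rule bij_betw_Collect) simp
  then have "card T = card {K \<in> parallel_classes (B i). block_through K x = block_through K y}"
    by (rule bij_betw_same_card)
  then have T: "card T * (q * q * r - 1) = \<kappa> * (q * r - 1)"
    using affine.card_common_classes[OF designs[OF i] _ x y \<open>x \<noteq> y\<close>]
      card_parallel_classes[OF i] two_le_kappa by simp
  have qr: "2 \<le> q * r" "2 * (q * r) \<le> q * q * r"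
    using mult_mono[OF q r] mult_right_mono[OF q, of "q * r"] by (simp_all add: mult.assoc)
  \<comment> \<open>Multiplying \<open>T\<close> by \<open>q - 1\<close> turns
    \<open>\<kappa>\<close> into \<open>q * q * r - 1\<close>, a positive factor that then cancels.
    So \<open>card T\<close> is \<open>(q * r - 1) / (q - 1)\<close>.\<close>
  have "card T * (q - 1) * (q * q * r - 1) = card T * (q * q * r - 1) * (q - 1)"
    by (simp only: ac_simps)
  also have "\<dots> = (\<kappa> * (q - 1)) * (q * r - 1)"
    unfolding T by (simp only: ac_simps)
  also have "\<dots> = (q * r - 1) * (q * q * r - 1)"
    unfolding kappa by (rule mult.commute)
  finally have "card T * (q - 1) * (q * q * r - 1) = (q * r - 1) * (q * q * r - 1)" .
  then have cT: "card T * (q - 1) = q * r - 1"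
    using qr by simp
  \<comment> \<open>Here \<open>(q * r - 1) + q * r * (q - 1) = q * q * r - 1\<close>. Thus
    \<open>q * r\<close> classes separate \<open>x\<close> from \<open>y\<close>.\<close>
  have "(card T + q * r) * (q - 1) = \<kappa> * (q - 1)"
    unfolding kappa add_mult_distrib cT using qr by (simp add: diff_mult_distrib2 ac_simps)
  then have kT: "\<kappa> = card T + q * r" using q by simp
  have inter: "card (P j - (blk i j x \<union> blk i j y)) + 2 * (q * r)
      = q * q * r + (if j \<in> T then q * r else 0)" if j: "j \<in> supp i" for j
  proof -
    have "blk i j x \<inter> blk i j y = {}" if "j \<notin> T"
    proof -
      have "blk i j x \<noteq> blk i j y" using that j unfolding T_def by blast
      then show ?thesis
        using partition_onD2[OF partition_C[of j i]] suppD[OF i j]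
          blk_in[OF i j x] blk_in[OF i j y] unfolding disjoint_def by blast
    qed
    moreover have "card (blk i j x \<inter> blk i j y) = q * r" if "j \<in> T"
      using that card_blk[OF i j x] unfolding T_def by auto
    ultimately show ?thesis using card_Diff_blk[OF i x i y, of j] j by auto
  qed
  have TS: "T \<subseteq> supp i" unfolding T_def by blast
  have "card (common_neighbours V adj x y) + \<kappa> * (2 * (q * r))
      = (\<Sum>j\<in>supp i. card (P j - (blk i j x \<union> blk i j y)) + 2 * (q * r))"
    using card_common_neighbours[OF i x i y] card_supp[OF i] by (simp add: sum.distrib)
  also have "\<dots> = (\<Sum>j\<in>supp i. q * q * r + (if j \<in> T then q * r else 0))"
    using inter by (intro sum.cong) auto
  also have "\<dots> = \<kappa> * (q * q * r) + card T * (q * r)"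
    using TS card_supp[OF i] finite_supp[of i]
    by (simp add: sum.distrib sum.If_cases Int_absorb1)
  finally have main: "card (common_neighbours V adj x y) + \<kappa> * (2 * (q * r))
      = \<kappa> * (q * q * r) + card T * (q * r)" .
  have le: "q * r + 1 \<le> q * q * r" using qr by linarith
  \<comment> \<open>The rest is a polynomial identity, computed over the integers;
    \<open>le'\<close> ensures that the nested subtractions in the goal do not truncate.\<close>
  have "int (\<kappa> * (q - 1)) = int (q * q * r) - 1"
    unfolding kappa using q r by (subst of_nat_diff) auto
  then have k: "int \<kappa> * (int q - 1) = int q * int q * int r - 1"
    using q by (simp add: of_nat_diff)
  have le': "q * r \<le> q * q * r" "1 \<le> q * q * r - q * r" using le by linarith+
  have "int (card (common_neighbours V adj x y))
      = int \<kappa> * (int q * int q * int r) + (int \<kappa> - int q * int r) * (int q * int r)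
        - int \<kappa> * (2 * (int q * int r))"
    using arg_cong[OF main, of int] kT by simp
  also have "\<dots> = int q * int r * (int \<kappa> * (int q - 1) - int q * int r)"
    by (simp add: algebra_simps)
  also have "\<dots> = int (q * r * (q * q * r - q * r - 1))"
    unfolding k of_nat_mult of_nat_diff[OF le'(1)] of_nat_diff[OF le'(2)] by simp
  finally show ?thesis by (simp only: of_nat_eq_iff)
qed

lemma card_common_different_parts:
  assumes i: "i \<in> {1..m}" "x \<in> P i" and i': "i' \<in> {1..m}" "y \<in> P i'" and "i \<noteq> i'"
  shows "card (common_neighbours V adj x y) = r * (q - 1)\<^sup>2 * l"
proof -
  have "card (P j - (blk i j x \<union> blk i' j y)) = r * (q - 1)\<^sup>2" if j: "j \<in> supp i \<inter> supp i'" for j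
  proof -
    have s: "j \<in> {1..m}" "i \<in> supp j" "i' \<in> supp j"
      using j suppD i(1) i'(1) by blast+
    have "e j i \<noteq> e j i'"
      using row[OF s(1)] s \<open>i \<noteq> i'\<close> unfolding bij_betw_def inj_on_def supp_def by blast
    then have "C j (e j i) \<noteq> C j (e j i')"
      using classes[OF s(1)] suppD[OF s(1)] s unfolding bij_betw_def inj_on_def by blast
    then have "card (blk i j x \<inter> blk i' j y) = r"
      using affine.card_Int_different_classes[OF designs[OF s(1)] class_in class_in] s blk_in i i' j
      by blast
    then have *: "card (P j - (blk i j x \<union> blk i' j y)) + 2 * (q * r) = q * q * r + r"
      using card_Diff_blk[OF i i' j] by simp
    \<comment> \<open>With \<open>t = q - 1\<close> the identity
      \<open>q * q * r - 2 * (q * r) + r = r * (q - 1)^2\<close> is free of subtraction.\<close>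
    obtain t where "q = Suc t" using q by (cases q) auto
    with * show ?thesis by (simp add: power2_eq_square algebra_simps)
  qed
  moreover have "card (supp i \<inter> supp i') = l"
    using common_columns[OF i(1) i'(1) \<open>i \<noteq> i'\<close>] unfolding supp_def
    by (simp add: Collect_conj_eq[symmetric] Int_def conj_ac)
  ultimately show ?thesis
    using card_common_neighbours[OF i i'] by simp
qed

lemma divisible_design_graph:
  "divisible_design_graph V adj (q * q * r * m) (q * r * (q * q * r - 1))
    (q * r * (q * q * r - q * r - 1)) (r * (q - 1)\<^sup>2 * l) m (q * q * r)"
proof -
  \<comment> \<open>Disjoint nonempty parts are distinct, so \<open>P\<close> is injective on the
    indices and the partition has exactly \<open>m\<close> classes.\<close>
  have ne: "P i \<noteq> {}" if "i \<in> {1..m}" for i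
    using card_part[OF that] q r by auto
  have inj: "inj_on P {1..m}"
    using ne part_unique by (intro inj_onI) blast
  have "card V = (\<Sum>i\<in>{1..m}. card (P i))"
    using finite_part part_unique by (intro card_UN_disjoint) blast+
  then have V: "card V = q * q * r * m" using card_part by simp
  have part: "partition_on V (P ` {1..m})"
  proof (rule partition_onI)
    show "disjnt p p'" if "p \<in> P ` {1..m}" "p' \<in> P ` {1..m}" "p \<noteq> p'" for p p'
      using that part_unique unfolding disjnt_def by blast
  qed (use ne in blast)+
  show ?thesis
    unfolding divisible_design_graph_def
  proof (intro conjI exI[of _ "P ` {1..m}"])
    show "card (P ` {1..m}) = m" using inj by (simp add: card_image)
    show "\<forall>c\<in>P ` {1..m}. \<forall>x\<in>c. \<forall>y\<in>c. x \<noteq> y \<longrightarrow>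
        card (common_neighbours V adj x y) = q * r * (q * q * r - q * r - 1)"
      using card_common_same_part by blast
    show "\<forall>c\<in>P ` {1..m}. \<forall>c'\<in>P ` {1..m}. c \<noteq> c' \<longrightarrow>
        (\<forall>x\<in>c. \<forall>y\<in>c'. card (common_neighbours V adj x y) = r * (q - 1)\<^sup>2 * l)"
      using card_common_different_parts by blast
    show "\<forall>c\<in>P ` {1..m}. card c = q * q * r" using card_part by blast
    show "\<forall>x\<in>V. card {y \<in> V. adj x y} = q * r * (q * q * r - 1)" using degree by blast
  qed (fact simple_graph V part)+
qed

end

section \<open>Instantiating the gluing with powers of \<open>q\<close>\<close>

theorem theorem1:
  fixes q d m \<kappa> l :: nat
    and X :: "'p set" and Y :: "'p set multiset"
    and A e :: "nat \<Rightarrow> nat \<Rightarrow> nat"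
    and P :: "nat \<Rightarrow> 'a set" and B :: "nat \<Rightarrow> 'a set set"
    and C :: "nat \<Rightarrow> nat \<Rightarrow> 'a set set"
    and \<sigma> :: "nat \<Rightarrow> nat \<Rightarrow> 'a set \<Rightarrow> 'a set"
  assumes "q \<ge> 2" and "d \<ge> 2"
    and "\<kappa> = (q ^ d - 1) div (q - 1)"
    and "symmetric_two_design X Y m \<kappa> l"
    and "incidence_matrix X Y m A"
    and "symmetric_matrix m A"
    and "symmetric_matrix m e"
    and "\<forall>i\<in>{1..m}. \<forall>j\<in>{1..m}. e i j = 0 \<longleftrightarrow> A i j = 0"
    and "\<forall>i\<in>{1..m}. bij_betw (e i) {j\<in>{1..m}. A i j \<noteq> 0} {1..\<kappa>}"
    and "\<forall>i\<in>{1..m}. affine_design (P i) (B i) q (q ^ (d - 2))"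
    and "disjoint_family_on P {1..m}"
    and "\<forall>i\<in>{1..m}. bij_betw (C i) {1..\<kappa>} (parallel_classes (B i))"
    and "\<forall>i\<in>{1..m}. \<forall>j\<in>{1..m}. e i j \<noteq> 0 \<longrightarrow>
           bij_betw (\<sigma> i j) (C i (e i j)) (C j (e j i))"
    and "\<forall>i\<in>{1..m}. \<forall>j\<in>{1..m}. i \<noteq> j \<and> e i j \<noteq> 0 \<longrightarrow>
           (\<forall>b \<in> C i (e i j). \<sigma> i j b = inv_into (C j (e j i)) (\<sigma> j i) b)"
    and "\<forall>i\<in>{1..m}. e i i \<noteq> 0 \<longrightarrow> (\<forall>b \<in> C i (e i i). \<sigma> i i b = b)"
  shows "divisible_design_graph (\<Union>i\<in>{1..m}. P i) (gamma_adj m e P C \<sigma>)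
           (q ^ d * m)
           (q ^ (d - 1) * (q ^ d - 1))
           (q ^ (d - 1) * (q ^ d - q ^ (d - 1) - 1))
           (q ^ (d - 2) * (q - 1)\<^sup>2 * l)
           m
           (q ^ d)"
proof -
  define r where "r = q ^ (d - 2)"
  obtain t where t: "d = Suc (Suc t)"
    using assms(2) by (metis add_2_eq_Suc le_Suc_ex)
  have pow: "q ^ (d - 1) = q * r" "q ^ d = q * q * r"
    unfolding r_def t by simp_all
  \<comment> \<open>The geometric sum factorisation over the integers shows that the
    \<open>div\<close> defining \<open>\<kappa>\<close> is exact.\<close>
  have "int q - 1 dvd int q ^ d - 1"
    using power_diff_1_eq[of "int q" d] by simp
  then have "int (q - 1) dvd int (q ^ d - 1)"
    using assms(1) by (simp add: of_nat_diff)
  then have "q - 1 dvd q ^ d - 1" by (simp only: of_nat_dvd_iff)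
  then have kappa: "\<kappa> * (q - 1) = q * q * r - 1"
    using assms(3) pow by simp
  have supp: "{j \<in> {1..m}. A i j \<noteq> 0} = {j \<in> {1..m}. e i j \<noteq> 0}" if "i \<in> {1..m}" for i
    using bspec[OF assms(8) that] by (intro Collect_cong conj_cong) simp_all
  interpret affine_gluing q r m \<kappa> l e P B C \<sigma>
  proof
    show "card {j \<in> {1..m}. e i j \<noteq> 0 \<and> e i' j \<noteq> 0} = l"
      if "i \<in> {1..m}" "i' \<in> {1..m}" "i \<noteq> i'" for i i'
    proof -
      have "{j \<in> {1..m}. e i j \<noteq> 0 \<and> e i' j \<noteq> 0} = {j \<in> {1..m}. A i j \<noteq> 0 \<and> A i' j \<noteq> 0}"
        using bspec[OF assms(8) that(1)] bspec[OF assms(8) that(2)]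
        by (intro Collect_cong conj_cong) simp_all
      then show ?thesis using card_common_columns[OF assms(4,5) that] by simp
    qed
    show "bij_betw (e i) {j \<in> {1..m}. e i j \<noteq> 0} {1..\<kappa>}" if "i \<in> {1..m}" for i
      using bspec[OF assms(9) that] unfolding supp[OF that] .
    show "affine_design (P i) (B i) q r" if "i \<in> {1..m}" for i
      using assms(10) that unfolding r_def by blast
    show "1 \<le> r" unfolding r_def using assms(1) by simp
    show "e i j = e j i" if "i \<in> {1..m}" "j \<in> {1..m}" for i j
      using assms(7) that unfolding symmetric_matrix_def by blast
    show "bij_betw (C i) {1..\<kappa>} (parallel_classes (B i))" if "i \<in> {1..m}" for i
      using assms(12) that by blast
    show "bij_betw (\<sigma> i j) (C i (e i j)) (C j (e j i))"
      if "i \<in> {1..m}" "j \<in> {1..m}" "e i j \<noteq> 0" for i j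
      using assms(13) that by blast
    show "\<sigma> i j b = inv_into (C j (e j i)) (\<sigma> j i) b"
      if "i \<in> {1..m}" "j \<in> {1..m}" "i \<noteq> j" "e i j \<noteq> 0" "b \<in> C i (e i j)" for i j b
      using assms(14) that by blast
    show "\<sigma> i i b = b" if "i \<in> {1..m}" "e i i \<noteq> 0" "b \<in> C i (e i i)" for i b
      using assms(15) that by blast
  qed (fact assms(1) kappa assms(11))+
  show ?thesis
    using divisible_design_graph unfolding pow r_def[symmetric] .
qed

end
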